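(* For all integers $1 \le k \le n$, \[\sum_{i=0}^{k}\binom{n}{i} \le \frac{k^{\hat p}-1}{k-1} + 2^n\left(1-2^{-k}\right)^{\hat p},\qquad\text{where } \hat p = \left\lfloor \frac{n-k}{\log_2\!\big(k/(1-2^{-k})\big)}\right\rfloor + 1,\] and where the quantity $\frac{k^{p}-1}{k-1}$ is understood as $\sum_{j=0}^{p-1}k^j$ (so it equals $p$ when $k=1$). *)

theory Defs
  imports Complex_Main
begin

text \<open>For \<open>1 \<le> k \<le> n\<close> the numerator is nonnegative and the logarithm is positive, so the floor is
  a nonnegative integer and \<open>nat\<close> does not truncate.\<close>

definition p_hat :: "nat \<Rightarrow> nat \<Rightarrow> nat" where
  "p_hat n k = nat \<lfloor>(real n - real k) / log 2 (real k / (1 - 1 / 2 ^ k))\<rfloor> + 1"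

end

theory Submission
  imports Defs
begin

text \<open>
  The partial row sum \<open>\<Sum>i\<le>m. n choose i\<close> counts the binary words of length \<open>n\<close> with at most \<open>m\<close>
  ones. For \<open>m \<le> n\<close> such a word either starts with \<open>m\<close> ones, and is then determined, or its first
  zero comes after \<open>j < m\<close> ones and is followed by a word of length \<open>n - j - 1\<close> with at most
  \<open>m - j\<close> ones. Relaxing \<open>m - j\<close> to \<open>m\<close> and iterating \<open>p\<close> times from the trivial bound \<open>2 ^ n\<close>
  gives the inequality for every \<open>p\<close>; words that become shorter than \<open>k\<close> on the way are harmless,
  because by Bernoulli's inequality the claimed bound is then at least \<open>2 ^ n\<close>. Passing from \<open>p\<close> to
  \<open>p + 1\<close> changes the bound by \<open>k ^ p - 2 ^ (n - k) * (1 - 1 / 2 ^ k) ^ p\<close>, so \<open>p = p_hat n k\<close>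
  minimises it.
\<close>

definition partial_row_sum :: "nat \<Rightarrow> nat \<Rightarrow> nat" where
  "partial_row_sum n m = (\<Sum>i\<le>m. n choose i)"

lemma partial_row_sum_0_right [simp]: "partial_row_sum n 0 = 1"
  by (simp add: partial_row_sum_def)

lemma partial_row_sum_Suc_Suc:
  "partial_row_sum (Suc n) (Suc m) = partial_row_sum n (Suc m) + partial_row_sum n m"
proof -
  have "partial_row_sum (Suc n) (Suc m) = 1 + (\<Sum>i\<le>m. n choose Suc i) + (\<Sum>i\<le>m. n choose i)"
    unfolding partial_row_sum_def by (subst sum.atMost_Suc_shift) (simp add: sum.distrib)
  also have "1 + (\<Sum>i\<le>m. n choose Suc i) = (\<Sum>i\<le>Suc m. n choose i)"
    by (subst sum.atMost_Suc_shift) simp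
  finally show ?thesis
    by (simp only: partial_row_sum_def)
qed

lemma partial_row_sum_mono: "m \<le> m' \<Longrightarrow> partial_row_sum n m \<le> partial_row_sum n m'"
  unfolding partial_row_sum_def by (intro sum_mono2) auto

lemma partial_row_sum_le_two_power: "partial_row_sum n m \<le> 2 ^ n"
proof -
  have "partial_row_sum n m \<le> partial_row_sum n (m + n)"
    by (simp add: partial_row_sum_mono)
  also have "\<dots> = (\<Sum>i\<le>n. n choose i)"
    unfolding partial_row_sum_def by (intro sum.mono_neutral_right) auto
  finally show ?thesis
    by (simp add: choose_row_sum)
qed

lemma real_partial_row_sum_le_two_power: "real (partial_row_sum n m) \<le> 2 ^ n"
  using of_nat_mono[OF partial_row_sum_le_two_power, where 'a = real] by simp

lemma partial_row_sum_first_zero: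
  "m \<le> n \<Longrightarrow> partial_row_sum n m = 1 + (\<Sum>j<m. partial_row_sum (n - Suc j) (m - j))"
proof (induction m arbitrary: n)
  case 0
  show ?case by simp
next
  case (Suc m)
  then obtain n' where n_eq: "n = Suc n'" and "m \<le> n'"
    by (cases n) auto
  have "partial_row_sum n (Suc m) = partial_row_sum n' (Suc m) + partial_row_sum n' m"
    unfolding n_eq by (rule partial_row_sum_Suc_Suc)
  also have "partial_row_sum n' m = 1 + (\<Sum>j<m. partial_row_sum (n' - Suc j) (m - j))"
    using \<open>m \<le> n'\<close> by (rule Suc.IH)
  finally show ?case
    unfolding n_eq by (subst sum.lessThan_Suc_shift) simp
qed

lemma partial_row_sum_le_first_zero:
  assumes "m \<le> n"
  shows "partial_row_sum n m \<le> 1 + (\<Sum>j<m. partial_row_sum (n - Suc j) m)"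
  unfolding partial_row_sum_first_zero[OF assms]
  by (intro add_left_mono sum_mono partial_row_sum_mono) simp

lemma diff_one_mult_sum_power_diff:
  fixes x :: "'a::comm_ring_1"
  assumes "k \<le> n"
  shows "(x - 1) * (\<Sum>j<k. x ^ (n - Suc j)) = x ^ n - x ^ (n - k)"
  using assms
proof (induction k)
  case 0
  show ?case by simp
next
  case (Suc k)
  then have "x ^ (n - k) = x * x ^ (n - Suc k)"
    by (metis Suc_diff_Suc Suc_le_lessD power_Suc)
  with Suc show ?case
    by (simp add: algebra_simps)
qed

definition iterated_bound :: "nat \<Rightarrow> nat \<Rightarrow> nat \<Rightarrow> real" where
  "iterated_bound k p n = (\<Sum>j<p. real k ^ j) + 2 ^ n * (1 - 1 / 2 ^ k) ^ p"

lemma iterated_bound_Suc: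
  assumes "k \<le> n"
  shows "iterated_bound k (Suc p) n = 1 + (\<Sum>j<k. iterated_bound k p (n - Suc j))"
proof -
  let ?c = "1 - 1 / 2 ^ k :: real"
  have sum_two_powers: "(\<Sum>j<k. 2 ^ (n - Suc j)) = 2 ^ n * ?c"
    using diff_one_mult_sum_power_diff[OF assms, of "2 :: real"] assms
    by (simp add: power_diff right_diff_distrib)
  have "(\<Sum>j<k. iterated_bound k p (n - Suc j))
      = real k * (\<Sum>l<p. real k ^ l) + (\<Sum>j<k. 2 ^ (n - Suc j)) * ?c ^ p"
    by (simp add: iterated_bound_def sum.distrib sum_distrib_right)
  also have "\<dots> = (\<Sum>l<p. real k ^ Suc l) + 2 ^ n * ?c ^ Suc p"
    by (simp add: sum_two_powers sum_distrib_left)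
  finally show ?thesis
    unfolding iterated_bound_def by (subst sum.lessThan_Suc_shift) simp
qed

lemma two_power_le_iterated_bound:
  assumes "1 \<le> k" "n \<le> k"
  shows "2 ^ n \<le> iterated_bound k p n"
proof -
  have "1 - real p / 2 ^ k \<le> (1 - 1 / 2 ^ k) ^ p"
    using Bernoulli_inequality[of "- 1 / 2 ^ k" p] by simp
  then have "2 ^ n * (1 - real p / 2 ^ k) \<le> 2 ^ n * (1 - 1 / 2 ^ k) ^ p"
    by (rule mult_left_mono) simp
  moreover have "2 ^ n / 2 ^ k * real p \<le> 1 * real p"
    using assms(2) by (intro mult_right_mono) auto
  moreover have "(\<Sum>j<p. 1) \<le> (\<Sum>j<p. real k ^ j)"
    using assms(1) by (intro sum_mono one_le_power) simp
  ultimately show ?thesis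
    by (simp add: iterated_bound_def right_diff_distrib)
qed

lemma partial_row_sum_le_iterated_bound:
  assumes "1 \<le> k"
  shows "real (partial_row_sum n k) \<le> iterated_bound k p n"
proof (induction p arbitrary: n)
  case 0
  show ?case
    using real_partial_row_sum_le_two_power by (simp add: iterated_bound_def)
next
  case (Suc p)
  show ?case
  proof (cases "k \<le> n")
    case True
    have "real (partial_row_sum n k) \<le> real (1 + (\<Sum>j<k. partial_row_sum (n - Suc j) k))"
      using True by (intro of_nat_mono partial_row_sum_le_first_zero)
    also have "\<dots> = 1 + (\<Sum>j<k. real (partial_row_sum (n - Suc j) k))"
      by simp
    also have "\<dots> \<le> 1 + (\<Sum>j<k. iterated_bound k p (n - Suc j))"
      by (intro add_left_mono sum_mono Suc.IH)
    also have "\<dots> = iterated_bound k (Suc p) n"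
      using True by (rule iterated_bound_Suc[symmetric])
    finally show ?thesis .
  next
    case False
    have "real (partial_row_sum n k) \<le> 2 ^ n"
      by (rule real_partial_row_sum_le_two_power)
    also have "\<dots> \<le> iterated_bound k (Suc p) n"
      using assms False by (intro two_power_le_iterated_bound) auto
    finally show ?thesis .
  qed
qed

theorem theorem2:
  fixes n k :: nat
  assumes "1 \<le> k" and "k \<le> n"
  shows "(\<Sum>i=0..k. real (n choose i))
           \<le> (\<Sum>j<p_hat n k. real k ^ j) + 2 ^ n * (1 - 1 / 2 ^ k) ^ p_hat n k"
proof -
  have "(\<Sum>i=0..k. real (n choose i)) = real (partial_row_sum n k)"
    by (simp add: partial_row_sum_def atLeast0AtMost)
  also have "\<dots> \<le> iterated_bound k (p_hat n k) n"
    using assms(1) by (rule partial_row_sum_le_iterated_bound)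
  finally show ?thesis
    unfolding iterated_bound_def .
qed

end
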